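(* Let $p$ be a prime number and let $d$ be a natural number with $d \geq 2$. For $c \in \mathbb{C}_p$ let $f_c : \hat{\mathbb{C}}_p \to \hat{\mathbb{C}}_p$ be the polynomial map $f_c(z) = z^d + c$ for $z \in \mathbb{C}_p$ and $f_c(\infty) = \infty$. Suppose that $d$ is not divisible by $p$ and that $c, c' \in \mathbb{C}_p$ satisfy $$\lim_{k \rightarrow \infty} |f_c^k(0)|_p = \lim_{k \rightarrow \infty} |f_{c'}^k(0)|_p = \infty \quad \text{and} \quad |c - c'|_p \leq |c|_p^{1/d}.$$ Then there exists a homeomorphism $h : \mathcal{J}(f_c) \rightarrow \mathcal{J}(f_{c'})$ such that $h \circ f_c = f_{c'} \circ h$ on the Julia set $\mathcal{J}(f_c)$ of $f_c$.
   Context: $\mathbb{C}_p$ is the field of $p$-adic complex numbers (the completion of the algebraic closure of the completion of $\mathbb{Q}$ with respect to the $p$-adic norm), with norm $|\cdot|_p$ extending the $p$-adic norm on $\mathbb{Q}$ normalized by $|p|_p = p^{-1}$. $\hat{\mathbb{C}}_p = \mathbb{C}_p \cup \{\infty\}$ is the projective line with the chordal metric $\rho_p(z,w) = \frac{|z-w|_p}{\max\{|z|_p,1\}\max\{|w|_p,1\}}$ for $z,w \in \mathbb{C}_p$, $\rho_p(z,\infty) = \frac{1}{\max\{|z|_p,1\}}$ for $z \in \mathbb{C}_p$, and $\rho_p(\infty,\infty)=0$. $f^k$ denotes the $k$-th iterate of $f$. The Fatou set $\mathcal{F}(f)$ of a polynomial map $f$ is the largest open subset of $\hat{\mathbb{C}}_p$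 on which the family $\{f^n\}_{n \in \mathbb{N}}$ is equicontinuous (at every point, with respect to $\rho_p$); the Julia set is $\mathcal{J}(f) = \hat{\mathbb{C}}_p \setminus \mathcal{F}(f)$, with the subspace topology. *)

theory Defs
  imports "HOL-Analysis.Analysis" "HOL-Computational_Algebra.Computational_Algebra"
begin

definition padic_norm_rat :: "nat \<Rightarrow> rat \<Rightarrow> real" where
  "padic_norm_rat p q =
     (if q = 0 then 0
      else let (a, b) = quotient_of q
           in real p powi (int (multiplicity (int p) b) - int (multiplicity (int p) a)))"

locale ultrametric_field =
  fixes nrm :: "'a::field_char_0 \<Rightarrow> real"
  assumes nrm_nonneg: "nrm x \<ge> 0"
    and nrm_eq_0_iff: "nrm x = 0 \<longleftrightarrow> x = 0"
    and nrm_mult: "nrm (x * y) = nrm x * nrm y"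
    and nrm_ultrametric: "nrm (x + y) \<le> max (nrm x) (nrm y)"
begin

lemma nrm_zero: "nrm 0 = 0"
  by (simp add: nrm_eq_0_iff)

lemma nrm_one: "nrm 1 = 1"
  using nrm_mult[of 1 1] nrm_eq_0_iff[of 1] by simp

lemma nrm_minus: "nrm (- x) = nrm x"
proof -
  have "nrm (- 1) * nrm (- 1) = 1"
    using nrm_mult[of "- 1" "- 1"] nrm_one by simp
  hence "nrm (- 1) = 1"
    using nrm_nonneg[of "- 1"] by (simp add: square_eq_1_iff)
  thus ?thesis
    using nrm_mult[of "- 1" x] by simp
qed

lemma nrm_minus_commute: "nrm (x - y) = nrm (y - x)"
  using nrm_minus[of "x - y"] by simp

lemma nrm_diff_ultrametric: "nrm (x - z) \<le> max (nrm (x - y)) (nrm (y - z))"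
  using nrm_ultrametric[of "x - y" "y - z"] by simp

sublocale Metric_space "UNIV :: 'a set" "\<lambda>x y. nrm (x - y)"
proof
  fix x y z :: 'a
  show "nrm (x - z) \<le> nrm (x - y) + nrm (y - z)"
    using nrm_diff_ultrametric[of x z y] nrm_nonneg[of "x - y"] nrm_nonneg[of "y - z"] by linarith
qed (auto simp: nrm_nonneg nrm_eq_0_iff nrm_minus_commute)

end

definition algebraic_elements_over :: "'a::field set \<Rightarrow> 'a set" where
  "algebraic_elements_over F =
     {x. \<exists>q :: 'a poly. q \<noteq> 0 \<and> (\<forall>i. coeff q i \<in> F) \<and> poly q x = 0}"

context ultrametric_field
begin

definition Qp :: "'a set" where
  "Qp = mtopology closure_of (range of_rat)"

definition Qp_alg :: "'a set" where
  "Qp_alg = algebraic_elements_over Qp"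

end

text \<open>
  A model of the field of p-adic complex numbers, presented by its tower
  \<open>\<rat> \<subseteq> \<rat>\<^sub>p \<subseteq> \<rat>\<^sub>p\<^sup>a\<^sup>l\<^sup>g \<subseteq> \<complex>\<^sub>p\<close> of subsets of one complete normed field: \<open>Qp\<close> is the
  topological closure of \<open>\<rat>\<close> (so, the ambient field being complete, a completion of \<open>\<rat>\<close> for the
  p-adic norm), \<open>Qp_alg\<close> is an algebraic closure of \<open>Qp\<close>, and the whole field is a completion of
  \<open>Qp_alg\<close>. These conditions determine the normed field up to isometric isomorphism. The
  norm is a parameter rather than a type class operation because it depends on \<open>p\<close>.
\<close>

locale padic_complex_field = ultrametric_field nrm
  for p :: nat and nrm :: "'a::field_char_0 \<Rightarrow> real" +
  assumes prime_p: "prime p"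
    and nrm_of_rat: "nrm (of_rat q) = padic_norm_rat p q"
    and complete: "mcomplete"
    and Qp_alg_closed:
      "\<lbrakk>\<forall>i. coeff f i \<in> Qp_alg; degree f > 0\<rbrakk> \<Longrightarrow> \<exists>x\<in>Qp_alg. poly f x = 0"
    and Qp_alg_dense: "mtopology closure_of Qp_alg = UNIV"

datatype 'a proj_line = Affine 'a | Infinity

fun chordal :: "('a::field_char_0 \<Rightarrow> real) \<Rightarrow> 'a proj_line \<Rightarrow> 'a proj_line \<Rightarrow> real" where
  "chordal nrm (Affine z) (Affine w) = nrm (z - w) / (max (nrm z) 1 * max (nrm w) 1)"
| "chordal nrm (Affine z) Infinity = 1 / max (nrm z) 1"
| "chordal nrm Infinity (Affine z) = 1 / max (nrm z) 1"
| "chordal nrm Infinity Infinity = 0"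

abbreviation chordal_topology :: "('a::field_char_0 \<Rightarrow> real) \<Rightarrow> 'a proj_line topology" where
  "chordal_topology nrm \<equiv> Metric_space.mtopology UNIV (chordal nrm)"

fun unicritical_map :: "nat \<Rightarrow> 'a::field_char_0 \<Rightarrow> 'a proj_line \<Rightarrow> 'a proj_line" where
  "unicritical_map d c (Affine z) = Affine (z ^ d + c)"
| "unicritical_map d c Infinity = Infinity"

lemma unicritical_map_funpow_Affine:
  "(unicritical_map d c ^^ k) (Affine z) = Affine (((\<lambda>z. z ^ d + c) ^^ k) z)"
  by (induction k) auto

definition iterates_equicontinuous_on ::
    "('a::field_char_0 \<Rightarrow> real) \<Rightarrow> ('a proj_line \<Rightarrow> 'a proj_line) \<Rightarrow> 'a proj_line set \<Rightarrow> bool" where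
  "iterates_equicontinuous_on nrm f U \<longleftrightarrow>
     (\<forall>z\<in>U. \<forall>\<epsilon>>0. \<exists>\<delta>>0. \<forall>w\<in>U. chordal nrm z w < \<delta> \<longrightarrow>
        (\<forall>n. chordal nrm ((f ^^ n) z) ((f ^^ n) w) < \<epsilon>))"

definition fatou_set ::
    "('a::field_char_0 \<Rightarrow> real) \<Rightarrow> ('a proj_line \<Rightarrow> 'a proj_line) \<Rightarrow> 'a proj_line set" where
  "fatou_set nrm f =
     \<Union>{U. openin (chordal_topology nrm) U \<and> iterates_equicontinuous_on nrm f U}"

definition julia_set ::
    "('a::field_char_0 \<Rightarrow> real) \<Rightarrow> ('a proj_line \<Rightarrow> 'a proj_line) \<Rightarrow> 'a proj_line set" where
  "julia_set nrm f = - fatou_set nrm f"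

context ultrametric_field
begin

lemma chordal_Metric_space: "Metric_space UNIV (chordal nrm)"
proof
  fix x y z :: "'a proj_line"
  show "0 \<le> chordal nrm x y"
    by (cases x; cases y) (auto simp: nrm_nonneg)
  show "chordal nrm x y = chordal nrm y x"
    by (cases x; cases y) (auto simp: nrm_minus_commute mult.commute)
  show "(chordal nrm x y = 0) = (x = y)"
    by (cases x; cases y) (auto simp: nrm_eq_0_iff nrm_zero max_def)
  show "chordal nrm x z \<le> chordal nrm x y + chordal nrm y z"
  proof -
    define m where "m a = max (nrm a) 1" for a
    have m1: "m a \<ge> 1" for a by (simp add: m_def)
    have m0: "m a > 0" for a using m1[of a] by linarith
    have dn: "nrm (a - b) \<ge> 0" for a b by (rule nrm_nonneg)
    have sub: "m a \<le> nrm (a - b) + m b" for a b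
      proof -
      have "nrm a \<le> nrm (a - b) + nrm b"
        using nrm_ultrametric[of "a - b" b, unfolded diff_add_cancel] dn[of a b] nrm_nonneg[of b]
        by linarith
      thus ?thesis
        using dn[of a b] unfolding m_def by linarith
    qed
    have dmax: "nrm (a - b) \<le> m a * m b" for a b
    proof -
      have "nrm (a - b) \<le> max (m a) (m b)"
        using nrm_ultrametric[of a "- b"] nrm_minus[of b] unfolding m_def by auto
      also have "\<dots> \<le> m a * m b"
        using m1[of a] m1[of b] m0[of a] m0[of b] by (auto simp: max_def)
      finally show ?thesis .
    qed
    have key: "nrm (a - e) * m b \<le> nrm (a - b) * m e + nrm (b - e) * m a" for a b e
    proof (cases "nrm b \<le> 1")
      case True
      hence mb: "m b = 1" by (simp add: m_def)
      have "nrm (a - e) \<le> nrm (a - b) + nrm (b - e)" by (rule triangle) auto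
      also have "\<dots> \<le> nrm (a - b) * m e + nrm (b - e) * m a"
        using mult_left_mono[OF m1[of e] dn[of a b]] mult_left_mono[OF m1[of a] dn[of b e]] by simp
      finally show ?thesis using mb by simp
    next
      case False
      hence mb: "m b = nrm b" by (simp add: m_def)
      have "nrm (a - e) * m b = nrm ((a - b) * e + (b - e) * a)"
        unfolding mb nrm_mult[symmetric] by (rule arg_cong[of _ _ nrm]) (simp add: algebra_simps)
      also have "\<dots> \<le> max (nrm ((a - b) * e)) (nrm ((b - e) * a))" by (rule nrm_ultrametric)
      also have "\<dots> \<le> nrm (a - b) * nrm e + nrm (b - e) * nrm a"
        using nrm_nonneg by (simp add: nrm_mult)
      also have "\<dots> \<le> nrm (a - b) * m e + nrm (b - e) * m a"
        by (intro add_mono mult_left_mono) (auto simp: m_def nrm_nonneg)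
      finally show ?thesis .
    qed
    note mm = m0[THEN less_imp_neq, THEN not_sym]
    show ?thesis
    proof (cases x; cases y; cases z)
      fix a b e assume *: "x = Affine a" "y = Affine b" "z = Affine e"
      have "nrm (a - e) / (m a * m e) = (nrm (a - e) * m b) / (m a * m b * m e)"
        using mm by (simp add: field_simps)
      also have "\<dots> \<le> (nrm (a - b) * m e + nrm (b - e) * m a) / (m a * m b * m e)"
        using key m0 by (intro divide_right_mono) (auto intro!: mult_nonneg_nonneg less_imp_le)
      also have "\<dots> = nrm (a - b) / (m a * m b) + nrm (b - e) / (m b * m e)"
        using mm by (simp add: field_simps)
      finally show ?thesis using * by (simp add: m_def)
    next
      fix a b assume *: "x = Affine a" "y = Affine b" "z = Infinity"
      have "m b \<le> nrm (a - b) + m a" using sub[of b a] by (simp add: nrm_minus_commute)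
      hence "1 / m a \<le> (nrm (a - b) + m a) / (m a * m b)"
        using m0[of a] m0[of b] by (simp add: field_simps)
      also have "\<dots> = nrm (a - b) / (m a * m b) + 1 / m b"
        using mm by (simp add: field_simps)
      finally show ?thesis using * by (simp add: m_def)
    next
      fix a e assume *: "x = Affine a" "y = Infinity" "z = Affine e"
      have "nrm (a - e) \<le> m a + m e"
      proof -
        have "nrm (a - e) \<le> max (m a) (m e)"
          using nrm_ultrametric[of a "- e"] nrm_minus[of e] unfolding m_def by auto
        thus ?thesis using m0[of a] m0[of e] by linarith
      qed
      hence "nrm (a - e) / (m a * m e) \<le> (m a + m e) / (m a * m e)"
        using m0 by (intro divide_right_mono) (auto intro!: mult_nonneg_nonneg less_imp_le)
      also have "\<dots> = 1 / m a + 1 / m e"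
        using mm by (simp add: field_simps)
      finally show ?thesis using * by (simp add: m_def)
    next
      fix b e assume *: "x = Infinity" "y = Affine b" "z = Affine e"
      have "m b \<le> nrm (b - e) + m e" by (rule sub)
      hence "1 / m e \<le> (nrm (b - e) + m e) / (m b * m e)"
        using m0[of e] m0[of b] by (simp add: field_simps)
      also have "\<dots> = 1 / m b + nrm (b - e) / (m b * m e)"
        using mm by (simp add: field_simps)
      finally show ?thesis using * by (simp add: m_def)
    qed auto
  qed
qed

lemma openin_fatou_set: "openin (chordal_topology nrm) (fatou_set nrm f)"
  unfolding fatou_set_def by (rule openin_Union) auto

lemma fatou_set_equicontinuous: "iterates_equicontinuous_on nrm f (fatou_set nrm f)"
  unfolding iterates_equicontinuous_on_def
proof (intro ballI allI impI)
  interpret C: Metric_space UNIV "chordal nrm" by (rule chordal_Metric_space)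
  fix z and \<epsilon> :: real assume "z \<in> fatou_set nrm f" "\<epsilon> > 0"
  then obtain U where U: "openin C.mtopology U" "iterates_equicontinuous_on nrm f U" "z \<in> U"
    unfolding fatou_set_def by blast
  then obtain \<delta> where \<delta>: "\<delta> > 0"
    "\<forall>w\<in>U. chordal nrm z w < \<delta> \<longrightarrow> (\<forall>n. chordal nrm ((f ^^ n) z) ((f ^^ n) w) < \<epsilon>)"
    using \<open>\<epsilon> > 0\<close> unfolding iterates_equicontinuous_on_def by meson
  obtain r where r: "r > 0" "C.mball z r \<subseteq> U"
    using U unfolding C.openin_mtopology by blast
  show "\<exists>\<delta>>0. \<forall>w\<in>fatou_set nrm f. chordal nrm z w < \<delta> \<longrightarrow>
          (\<forall>n. chordal nrm ((f ^^ n) z) ((f ^^ n) w) < \<epsilon>)"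
    using \<delta> r by (intro exI[of _ "min \<delta> r"]) (auto simp: C.mball_def)
qed

lemma fatou_set_greatest:
  assumes "openin (chordal_topology nrm) U" "iterates_equicontinuous_on nrm f U"
  shows "U \<subseteq> fatou_set nrm f"
  using assms unfolding fatou_set_def by blast

end

end

theory Submission
  imports Defs
begin

text \<open>
  Put \<open>R = |c|\<^sup>1\<^sup>/\<^sup>d\<close>; unboundedness of the critical orbit means \<open>R > 1\<close>. A point with \<open>|z| \<noteq> R\<close> escapes, so
  the Julia set is the set of points whose whole orbit lies on the sphere \<open>|z| = R\<close>: chordal distances
  do not increase near infinity, whereas on the sphere \<open>f\<close> stretches distances below \<open>R\<close> by exactly
  \<open>R\<^sup>d\<^sup>-\<^sup>1\<close>, because \<open>|d| = 1\<close>. If \<open>|c - c'| \<le> R\<close>, each point \<open>z\<close> of the first Julia set is shadowed by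
  exactly one point \<open>h z\<close> of the second, in the sense that the orbits stay at distance less than \<open>R\<close>.
  Uniqueness is expansion; existence comes from taking \<open>d\<close>-th roots backwards along the orbit and
  passing to a limit. Uniqueness makes \<open>h\<close> a conjugacy. Moreover, the distance of two points is
  determined, through the expansion factor, by the first time at which their orbits are \<open>R\<close> apart,
  and \<open>h\<close> preserves this time, so \<open>h\<close> is even an isometry.
\<close>

section \<open>Powers in ultrametric fields\<close>

context ultrametric_field
begin

lemma nrm_diff_le_max: "nrm (x - y) \<le> max (nrm x) (nrm y)"
  using nrm_ultrametric[of x "- y"] by (simp add: nrm_minus)

text \<open>The isosceles principle: were \<open>y\<close> smaller than \<open>x\<close>, then
  \<open>x = (x - y) + y\<close> would be a sum of two terms smaller than \<open>x\<close>.\<close>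

lemma nrm_eq_of_diff_less:
  assumes "nrm (x - y) < nrm x"
  shows "nrm y = nrm x"
proof (rule antisym)
  show "nrm y \<le> nrm x"
    using nrm_diff_le_max[of x "x - y"] assms by simp
  show "nrm x \<le> nrm y"
    using nrm_ultrametric[of "x - y" y] assms by (auto simp: max_def split: if_splits)
qed

lemma nrm_power: "nrm (x ^ n) = nrm x ^ n"
  by (induction n) (simp_all add: nrm_one nrm_mult)

lemma nrm_divide: "nrm (x / y) = nrm x / nrm y"
proof (cases "y = 0")
  case False
  have "nrm x = nrm (x / y) * nrm y"
    using False by (simp flip: nrm_mult)
  then show ?thesis
    using False by (simp add: nrm_eq_0_iff)
qed (simp add: nrm_zero)

lemma nrm_sum_le:
  assumes "\<And>i. i \<in> A \<Longrightarrow> nrm (f i) \<le> B" "0 \<le> B"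
  shows "nrm (sum f A) \<le> B"
proof (cases "finite A")
  case True
  then show ?thesis using assms(1)
  proof (induction A rule: finite_induct)
    case (insert a A)
    have "nrm (f a + sum f A) \<le> max (nrm (f a)) (nrm (sum f A))"
      by (rule nrm_ultrametric)
    also have "\<dots> \<le> B" using insert by auto
    finally show ?case using insert by simp
  qed (use assms(2) in \<open>simp add: nrm_zero\<close>)
qed (use assms(2) in \<open>simp add: nrm_zero\<close>)

lemma nrm_power_diff_le:
  "nrm (x ^ n - y ^ n) \<le> nrm (x - y) * max (nrm x) (nrm y) ^ (n - 1)"
proof -
  let ?m = "max (nrm x) (nrm y)"
  have m: "0 \<le> ?m" by (simp add: nrm_nonneg max.coboundedI1)
  have "nrm (\<Sum>i<n. y ^ (n - Suc i) * x ^ i) \<le> ?m ^ (n - 1)"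
  proof (rule nrm_sum_le)
    fix i assume "i \<in> {..<n}"
    then have n: "n - 1 = (n - Suc i) + i" by simp
    have "nrm (y ^ (n - Suc i) * x ^ i) \<le> ?m ^ (n - Suc i) * ?m ^ i"
      unfolding nrm_mult nrm_power
      by (intro mult_mono power_mono) (auto simp: nrm_nonneg m)
    then show "nrm (y ^ (n - Suc i) * x ^ i) \<le> ?m ^ (n - 1)"
      unfolding n power_add .
  qed (simp add: m)
  then show ?thesis
    unfolding power_diff_sumr2 nrm_mult by (intro mult_left_mono nrm_nonneg)
qed

lemma nrm_mult_diff_one_le:
  assumes "nrm (x - 1) \<le> r" "nrm (y - 1) \<le> r" "r \<le> 1"
  shows "nrm (x * y - 1) \<le> r"
proof -
  have "nrm x \<le> 1"
    using nrm_ultrametric[of "x - 1" 1] assms by (simp add: nrm_one)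
  then have "nrm (x * (y - 1)) \<le> 1 * r"
    unfolding nrm_mult using assms by (intro mult_mono) (auto simp: nrm_nonneg)
  then show ?thesis
    using nrm_ultrametric[of "x * (y - 1)" "x - 1"] assms by (simp add: algebra_simps)
qed

lemma nrm_power_diff_one_le:
  assumes "nrm (x - 1) \<le> r" "r \<le> 1"
  shows "nrm (x ^ n - 1) \<le> r"
proof (induction n)
  case 0
  then show ?case using order_trans[OF nrm_nonneg assms(1)] by (simp add: nrm_zero)
next
  case (Suc n)
  then show ?case using assms by (auto intro: nrm_mult_diff_one_le)
qed

text \<open>Each of the \<open>n\<close> monomials is \<open>r\<close>-close to 1, so the difference
  quotient of the power map is \<open>r\<close>-close to its derivative \<open>n\<close> at 1. Both
  the exact expansion and the contraction of the Newton map rest on this.\<close>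

lemma nrm_power_quotient_le:
  assumes "nrm (x - 1) \<le> r" "nrm (y - 1) \<le> r" "r \<le> 1"
  shows "nrm ((\<Sum>i<n. y ^ (n - Suc i) * x ^ i) - of_nat n) \<le> r"
proof -
  have "nrm (\<Sum>i<n. y ^ (n - Suc i) * x ^ i - 1) \<le> r"
    using assms order_trans[OF nrm_nonneg assms(1)]
    by (intro nrm_sum_le nrm_mult_diff_one_le nrm_power_diff_one_le) auto
  then show ?thesis by (simp add: sum_subtractf)
qed

text \<open>The unit hypothesis on \<open>n\<close> is where \<open>p\<close> not dividing the degree enters.\<close>

lemma nrm_power_diff_eq:
  assumes n: "nrm (of_nat n) = 1" and ab: "nrm (a - b) < nrm a"
  shows "nrm (a ^ n - b ^ n) = nrm a ^ (n - 1) * nrm (a - b)"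
proof -
  have a: "nrm a > 0" using ab nrm_nonneg[of "a - b"] by linarith
  then have a0: "a \<noteq> 0" by (auto simp: nrm_zero)
  have n0: "n > 0" using n nrm_zero by (metis gr0I of_nat_0 zero_neq_one)
  \<comment> \<open>Scaling by \<open>a\<close> moves the comparison to the pair 1 and
    \<open>u\<close>, where the difference quotient \<open>s\<close> is close to \<open>n\<close>
    and hence also has norm 1.\<close>
  define u where "u = b / a"
  have "nrm (u - 1) = nrm (b - a) / nrm a"
    unfolding nrm_divide[symmetric] u_def using a0 by (simp add: field_simps)
  then have u1: "nrm (u - 1) < 1"
    using ab a by (simp add: nrm_minus_commute)
  define s where "s = (\<Sum>i<n. u ^ (n - Suc i) * 1 ^ i)"
  have "nrm (s - of_nat n) \<le> nrm (u - 1)"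
    unfolding s_def using u1 by (intro nrm_power_quotient_le) (auto simp: nrm_zero nrm_nonneg)
  then have "nrm s = 1"
    using nrm_eq_of_diff_less[of "of_nat n" s] u1 n by (simp add: nrm_minus_commute)
  have b: "b = a * u" using a0 by (simp add: u_def)
  have "a ^ n - b ^ n = a ^ n * (1 ^ n - u ^ n)"
    unfolding b by (simp add: algebra_simps)
  also have "\<dots> = a ^ n * ((1 - u) * s)"
    unfolding s_def power_diff_sumr2 ..
  also have "\<dots> = a ^ (n - 1) * (a - b) * s"
    using n0 unfolding b by (cases n) (auto simp: algebra_simps)
  finally show ?thesis
    using \<open>nrm s = 1\<close> by (simp add: nrm_mult nrm_power)
qed

section \<open>Extraction of roots\<close>

text \<open>A case of Hensel's lemma: a Newton map contracts the complete ball of radius |v - 1|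
  about 1, and its fixed point is the root.\<close>

lemma exists_root_near_one:
  assumes complete: mcomplete and n: "nrm (of_nat n) = 1" and v: "nrm (v - 1) < 1"
  shows "\<exists>x. x ^ n = v \<and> nrm (x - 1) < 1"
proof -
  define r where "r = nrm (v - 1)"
  have r: "0 \<le> r" "r < 1" using v by (auto simp: r_def nrm_nonneg)
  have n0: "(of_nat n :: 'a) \<noteq> 0" using n nrm_zero by (metis zero_neq_one)
  \<comment> \<open>Newton step for \<open>x\<^sup>n = v\<close> with the derivative frozen at \<open>1\<close>\<close>
  define N where "N x = x - (x ^ n - v) / of_nat n" for x :: 'a
  have N_diff: "nrm (N x - N y) \<le> r * nrm (x - y)"
    if "nrm (x - 1) \<le> r" "nrm (y - 1) \<le> r" for x y
  proof -
    define s where "s = (\<Sum>i<n. y ^ (n - Suc i) * x ^ i)"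
    have xy: "x ^ n - y ^ n = (x - y) * s" unfolding s_def by (rule power_diff_sumr2)
    have "N x - N y = (x - y) - (x ^ n - y ^ n) / of_nat n"
      by (simp add: N_def diff_divide_distrib)
    also have "\<dots> = (x - y) * (of_nat n - s) / of_nat n"
      using n0 unfolding xy by (simp add: field_simps)
    finally have "nrm (N x - N y) = nrm (x - y) * nrm (s - of_nat n)"
      by (simp add: nrm_divide nrm_mult n nrm_minus_commute)
    also have "\<dots> \<le> nrm (x - y) * r"
      unfolding s_def using that r by (intro mult_left_mono nrm_power_quotient_le nrm_nonneg) auto
    finally show ?thesis by (simp add: mult.commute)
  qed
  \<comment> \<open>The centre moves by exactly \<open>r\<close>, so contraction and the ultrametric
    inequality keep the ball of radius \<open>r\<close> invariant.\<close>
  have N1: "nrm (N 1 - 1) = r"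
    using n by (simp add: N_def nrm_divide nrm_minus r_def nrm_minus_commute)
  have N_near: "nrm (N x - 1) \<le> r" if "nrm (x - 1) \<le> r" for x
  proof -
    have "nrm (N x - N 1) \<le> r * nrm (x - 1)"
      using N_diff[of x 1] that r by (simp add: nrm_zero)
    also have "\<dots> \<le> 1 * r" using that r by (intro mult_mono) (auto simp: nrm_nonneg)
    finally have "nrm (N x - N 1) \<le> r" by simp
    then show ?thesis
      using nrm_ultrametric[of "N x - N 1" "N 1 - 1"] N1 by simp
  qed
  define D where "D = {x. nrm (x - 1) \<le> r}"
  interpret D: Submetric UNIV "\<lambda>x y. nrm (x - y)" D by unfold_locales simp
  have "D = mcball 1 r" by (auto simp: D_def mcball_def nrm_minus_commute)
  then have "D.sub.mcomplete"
    using complete closedin_mcball D.closedin_mcomplete_imp_mcomplete by metis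
  moreover have "D \<noteq> {}" using r by (auto simp: D_def nrm_zero intro: exI[of _ 1])
  ultimately obtain x where "x \<in> D" "N x = x"
    using D.sub.Banach_fixedpoint_thm[of N r] N_near N_diff r(2)
    by (auto simp: D_def)
  then show ?thesis
    using n0 r by (auto simp: N_def D_def)
qed

lemma exists_root_near:
  assumes complete: mcomplete and n: "nrm (of_nat n) = 1" and v: "nrm (v - a ^ n) < nrm a ^ n"
  shows "\<exists>x. x ^ n = v \<and> nrm (x - a) < nrm a"
proof -
  have n0: "n \<noteq> 0" using n nrm_zero by (metis of_nat_0 zero_neq_one)
  have a: "a \<noteq> 0" 
    using v n0 nrm_nonneg[of v] by (auto simp: nrm_zero zero_power)
  then have na: "nrm a > 0" using nrm_nonneg[of a] nrm_eq_0_iff[of a] by linarith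
  have "v / a ^ n - 1 = (v - a ^ n) / a ^ n" using a by (simp add: field_simps)
  then have "nrm (v / a ^ n - 1) < 1"
    using v na by (simp add: nrm_divide nrm_power)
  then obtain x where x: "x ^ n = v / a ^ n" "nrm (x - 1) < 1"
    using exists_root_near_one[OF complete n] by blast
  have "a * x - a = a * (x - 1)" by (simp add: algebra_simps)
  then have "nrm (a * x - a) < nrm a"
    using x na by (simp add: nrm_mult)
  moreover have "(a * x) ^ n = v" using x a by (simp add: power_mult_distrib)
  ultimately show ?thesis by blast
qed

end

section \<open>Unicritical polynomials of degree prime to the residue characteristic\<close>

text \<open>The coefficient \<open>c\<close> is left variable so that both maps share one
  \<open>R\<close>; lemmas that need the link assume \<open>nrm c = R ^ d\<close>.\<close>

locale tame_unicritical = padic_complex_field p nrm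
  for p :: nat and nrm :: "'a::field_char_0 \<Rightarrow> real" +
  fixes d :: nat and R :: real
  assumes d_ge_2: "d \<ge> 2" and p_not_dvd_d: "\<not> p dvd d" and R_gt_1: "R > 1"
begin

definition unicrit :: "'a \<Rightarrow> 'a \<Rightarrow> 'a" where
  "unicrit c z = z ^ d + c"

text \<open>Equality instead of a bound, because expansion needs points exactly on the sphere;
  \<open>filled_julia_iff\<close> relates the two.\<close>

definition filled_julia :: "'a \<Rightarrow> 'a set" where
  "filled_julia c = {z. \<forall>n. nrm ((unicrit c ^^ n) z) = R}"

lemma filled_juliaD: "z \<in> filled_julia c \<Longrightarrow> nrm ((unicrit c ^^ n) z) = R"
  by (simp add: filled_julia_def)

lemma unicrit_mem_filled_julia:
  assumes "z \<in> filled_julia c"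
  shows "unicrit c z \<in> filled_julia c"
  using filled_juliaD[OF assms, of "Suc n" for n]
  by (simp add: filled_julia_def funpow_Suc_right del: funpow.simps)

lemma nrm_degree: "nrm (of_nat d) = 1"
proof -
  have "\<not> int p dvd int d" using p_not_dvd_d by simp
  then have "multiplicity (int p) (int d) = 0" by (rule not_dvd_imp_multiplicity_0)
  then show ?thesis
    using nrm_of_rat[of "of_nat d"] d_ge_2 by (simp add: padic_norm_rat_def)
qed

lemma nrm_p: "nrm (of_nat p) = 1 / real p"
proof -
  have p: "p > 1" using prime_p by (rule prime_gt_1_nat)
  then have "multiplicity (int p) (int p) = 1"
    by (intro multiplicity_self) auto
  then show ?thesis
    using nrm_of_rat[of "of_nat p"] p
    by (simp add: padic_norm_rat_def power_int_minus field_simps)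
qed

text \<open>Nontriviality of the norm: it supplies points arbitrarily near a given one, against
  which equicontinuity is tested.\<close>

lemma exists_small_nonzero:
  assumes "e > 0"
  shows "\<exists>x. x \<noteq> 0 \<and> nrm x < e"
proof -
  have p: "p > 1" using prime_p by (rule prime_gt_1_nat)
  then obtain n where "(1 / real p) ^ n < e"
    using real_arch_pow_inv[OF assms, of "1 / real p"] by auto
  then have "nrm (of_nat p ^ n) < e" by (simp add: nrm_power nrm_p)
  then show ?thesis using p by (intro exI[of _ "of_nat p ^ n"]) simp
qed

lemma R_less_power: "R < R ^ d"
  using power_strict_increasing[of 1 d R] d_ge_2 R_gt_1 by simp

lemma expansion_gt_1: "1 < R ^ (d - 1)"
  using R_gt_1 d_ge_2 by (intro one_less_power) auto

lemma nrm_unicrit_large: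
  assumes "nrm c = R ^ d" "R < nrm z"
  shows "nrm (unicrit c z) = nrm z ^ d"
proof -
  have "nrm (z ^ d - unicrit c z) < nrm (z ^ d)"
    using assms R_gt_1 d_ge_2
    by (simp add: unicrit_def nrm_minus nrm_power power_strict_mono)
  then show ?thesis by (metis nrm_eq_of_diff_less nrm_power)
qed

lemma nrm_unicrit_small:
  assumes "nrm c = R ^ d" "nrm z < R"
  shows "nrm (unicrit c z) = R ^ d"
proof -
  have "nrm (c - unicrit c z) < nrm c"
    using assms d_ge_2 nrm_nonneg[of z]
    by (simp add: unicrit_def nrm_minus nrm_power power_strict_mono)
  then show ?thesis using assms by (metis nrm_eq_of_diff_less)
qed

text \<open>A point strictly inside the sphere is thrown to norm \<open>R ^ d > R\<close> in one
  step, as \<open>c\<close> dominates there.\<close>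

lemma filled_julia_iff:
  assumes c: "nrm c = R ^ d"
  shows "z \<in> filled_julia c \<longleftrightarrow> (\<forall>n. nrm ((unicrit c ^^ n) z) \<le> R)"
proof
  assume le: "\<forall>n. nrm ((unicrit c ^^ n) z) \<le> R"
  have "\<not> nrm ((unicrit c ^^ n) z) < R" for n
  proof
    assume "nrm ((unicrit c ^^ n) z) < R"
    then have "nrm ((unicrit c ^^ Suc n) z) = R ^ d"
      using nrm_unicrit_small[OF c] by simp
    then show False using le R_less_power by (metis leD)
  qed
  then show "z \<in> filled_julia c"
    using le by (auto simp: filled_julia_def intro!: antisym simp: not_less)
qed (simp add: filled_julia_def)

subsection \<open>Expansion\<close>

text \<open>The factor is the norm of the derivative of the map at \<open>a\<close>.\<close>

lemma nrm_unicrit_diff: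
  assumes "nrm a = R" "nrm (a - b) < R"
  shows "nrm (unicrit c a - unicrit c b) = R ^ (d - 1) * nrm (a - b)"
  using nrm_power_diff_eq[OF nrm_degree, of a b] assms by (simp add: unicrit_def)

lemma nrm_iterate_diff:
  assumes "\<And>k. k < n \<Longrightarrow> nrm ((unicrit c ^^ k) a) = R"
    and "\<And>k. k < n \<Longrightarrow> nrm ((unicrit c ^^ k) a - (unicrit c ^^ k) b) < R"
  shows "nrm ((unicrit c ^^ n) a - (unicrit c ^^ n) b) = (R ^ (d - 1)) ^ n * nrm (a - b)"
  using assms
proof (induction n)
  case (Suc n)
  have "nrm ((unicrit c ^^ Suc n) a - (unicrit c ^^ Suc n) b)
      = R ^ (d - 1) * nrm ((unicrit c ^^ n) a - (unicrit c ^^ n) b)"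
    using Suc.prems[of n] by (simp add: nrm_unicrit_diff)
  then show ?case using Suc by simp
qed simp

text \<open>Closeness at earlier times makes the expansion exact up to time \<open>k\<close>, and
  the distance so computed is at most its value at time \<open>n\<close>.\<close>

lemma iterates_stay_close:
  assumes "\<And>k. k < n \<Longrightarrow> nrm ((unicrit c ^^ k) a) = R"
    and "(R ^ (d - 1)) ^ n * nrm (a - b) < R"
    and "k \<le> n"
  shows "nrm ((unicrit c ^^ k) a - (unicrit c ^^ k) b) < R"
  using assms(3)
proof (induction k rule: less_induct)
  case (less k)
  have "nrm ((unicrit c ^^ k) a - (unicrit c ^^ k) b) = (R ^ (d - 1)) ^ k * nrm (a - b)"
    using less assms(1) by (intro nrm_iterate_diff) auto
  also have "\<dots> \<le> (R ^ (d - 1)) ^ n * nrm (a - b)"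
    using less.prems expansion_gt_1
    by (intro mult_right_mono power_increasing nrm_nonneg) auto
  finally show ?case using assms(2) by linarith
qed

text \<open>Expansivity: while the orbits stay close, their distance grows geometrically, which
  cannot last.\<close>

lemma first_separation:
  assumes a: "a \<in> filled_julia c" and "a \<noteq> b"
  obtains n where "R \<le> nrm ((unicrit c ^^ n) a - (unicrit c ^^ n) b)"
    and "\<And>k. k < n \<Longrightarrow> nrm ((unicrit c ^^ k) a - (unicrit c ^^ k) b) < R"
proof -
  let ?P = "\<lambda>n. R \<le> nrm ((unicrit c ^^ n) a - (unicrit c ^^ n) b)"
  have pos: "nrm (a - b) > 0"
    using \<open>a \<noteq> b\<close> nrm_nonneg[of "a - b"] nrm_eq_0_iff[of "a - b"] by fastforce
  have "\<exists>n. ?P n"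
  proof (rule ccontr)
    assume "\<nexists>n. ?P n"
    then have close: "nrm ((unicrit c ^^ n) a - (unicrit c ^^ n) b) < R" for n
      by (simp add: not_le)
    obtain n where "R / nrm (a - b) < (R ^ (d - 1)) ^ n"
      using real_arch_pow[OF expansion_gt_1] by blast
    then show False
      using close[of n] pos nrm_iterate_diff[of n c a b] close filled_juliaD[OF a]
      by (simp add: field_simps)
  qed
  then obtain n where "?P n" "\<forall>k<n. \<not> ?P k"
    using exists_least_iff[of ?P] by blast
  then show ?thesis using that by (simp add: not_le)
qed

subsection \<open>The Julia set\<close>

text \<open>\<open>B\<close> is the loss when a chordal denominator at the image is replaced by the
  \<open>d\<close>-th power of the one at the point. It is 1 near infinity and \<open>R ^ d\<close>
  globally.\<close>

lemma chordal_unicritical_map_le: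
  assumes B: "1 \<le> B"
    and x: "\<And>z. x = Affine z \<Longrightarrow> max (nrm z) 1 ^ d \<le> B * max (nrm (unicrit c z)) 1"
    and y: "\<And>z. y = Affine z \<Longrightarrow> max (nrm z) 1 ^ d \<le> B * max (nrm (unicrit c z)) 1"
  shows "chordal nrm (unicritical_map d c x) (unicritical_map d c y) \<le> B\<^sup>2 * chordal nrm x y"
proof -
  define m where "m z = max (nrm z) 1" for z
  have m1: "1 \<le> m z" and m0: "0 < m z" for z
    by (auto simp: m_def)
  have inv: "1 / m (unicrit c z) \<le> B / m z ^ d" if "x = Affine z \<or> y = Affine z" for z
    using that x[of z] y[of z] m0[of z] m0[of "unicrit c z"]
    by (auto simp: field_simps simp flip: m_def)
  have inf: "1 / m (unicrit c z) \<le> B\<^sup>2 * (1 / m z)" if "x = Affine z \<or> y = Affine z" for z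
  proof -
    have "m z \<le> m z ^ d" using m1 d_ge_2 by (intro self_le_power) auto
    then have "B / m z ^ d \<le> B / m z"
      using B m0[of z] by (intro divide_left_mono) auto
    also have "\<dots> \<le> B\<^sup>2 * (1 / m z)"
      using B m0[of z] self_le_power[of B 2] by (simp add: divide_right_mono)
    finally show ?thesis using inv[OF that] by linarith
  qed
  have fin: "nrm (unicrit c z - unicrit c w) / (m (unicrit c z) * m (unicrit c w))
      \<le> B\<^sup>2 * (nrm (z - w) / (m z * m w))" if xy: "x = Affine z" "y = Affine w" for z w
  proof -
    have "max (nrm z) (nrm w) \<le> m z * m w"
    proof -
      have "m z \<le> m z * m w" "m w \<le> m z * m w"
        using m1[of z] m1[of w] m0[of z] m0[of w] by auto
      then show ?thesis by (auto simp: m_def)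
    qed
    \<comment> \<open>Passing to the product leaves exactly one factor \<open>m z * m w\<close>
      after division by \<open>m z ^ d * m w ^ d\<close>.\<close>
    then have "max (nrm z) (nrm w) ^ (d - 1) \<le> (m z * m w) ^ (d - 1)"
      by (intro power_mono) (auto simp: nrm_nonneg le_max_iff_disj)
    then have "nrm (unicrit c z - unicrit c w) \<le> nrm (z - w) * (m z * m w) ^ (d - 1)"
      using nrm_power_diff_le[of z d w] mult_left_mono[OF _ nrm_nonneg[of "z - w"]]
      by (simp add: unicrit_def) (meson order_trans)
    then have "nrm (unicrit c z - unicrit c w) * (1 / m (unicrit c z) * (1 / m (unicrit c w)))
        \<le> nrm (z - w) * (m z * m w) ^ (d - 1) * (B / m z ^ d * (B / m w ^ d))"
      using m0 B inv[of z] inv[of w] xy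
      by (intro mult_mono) (auto simp: nrm_nonneg less_imp_le intro!: mult_nonneg_nonneg divide_nonneg_nonneg zero_le_power)
    also have "\<dots> = B\<^sup>2 * (nrm (z - w) / (m z * m w))"
      using m0[of z] m0[of w] d_ge_2
      by (cases d) (auto simp: field_simps power2_eq_square)
    finally show ?thesis by simp
  qed
  show ?thesis
    using fin inf by (cases x; cases y) (auto simp: m_def unicrit_def)
qed

text \<open>The chordal form of escape covers \<open>Infinity\<close> together with the affine
  points.\<close>

lemma escape_region_iff: "chordal nrm (Affine z) Infinity < 1 / R \<longleftrightarrow> R < nrm z"
  using R_gt_1 by (auto simp: field_simps max_def)

lemma escape_region_invariant:
  assumes c: "nrm c = R ^ d" and "chordal nrm x Infinity < 1 / R"
  shows "chordal nrm (unicritical_map d c x) Infinity < 1 / R"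
proof (cases x)
  case (Affine z)
  then have z: "R < nrm z" using assms escape_region_iff by simp
  then have "R ^ d < nrm z ^ d" using R_gt_1 d_ge_2 by (intro power_strict_mono) auto
  then have "R < nrm (unicrit c z)"
    using nrm_unicrit_large[OF c z] R_less_power by linarith
  then show ?thesis
    using escape_region_iff Affine by (simp add: unicrit_def del: chordal.simps)
qed (use R_gt_1 in simp)

lemma chordal_escape_region_le:
  assumes c: "nrm c = R ^ d"
    and "chordal nrm x Infinity < 1 / R" "chordal nrm y Infinity < 1 / R"
  shows "chordal nrm (unicritical_map d c x) (unicritical_map d c y) \<le> chordal nrm x y"
proof -
  have "max (nrm z) 1 ^ d \<le> 1 * max (nrm (unicrit c z)) 1" if "R < nrm z" for z
    using nrm_unicrit_large[OF c that] that R_gt_1 by (auto simp: max_def)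
  then have "chordal nrm (unicritical_map d c x) (unicritical_map d c y) \<le> 1\<^sup>2 * chordal nrm x y"
    using assms escape_region_iff
    by (intro chordal_unicritical_map_le) (auto simp del: chordal.simps)
  then show ?thesis by simp
qed

lemma chordal_unicritical_map_Lipschitz:
  assumes c: "nrm c = R ^ d"
  shows "chordal nrm (unicritical_map d c x) (unicritical_map d c y) \<le> (R ^ d)\<^sup>2 * chordal nrm x y"
proof -
  have "max (nrm z) 1 ^ d \<le> R ^ d * max (nrm (unicrit c z)) 1" for z
  proof (cases "R < nrm z")
    case True
    then have "max (nrm z) 1 ^ d \<le> 1 * max (nrm (unicrit c z)) 1"
      using nrm_unicrit_large[OF c True] R_gt_1 by (auto simp: max_def)
    also have "\<dots> \<le> R ^ d * max (nrm (unicrit c z)) 1"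
      using R_gt_1 by (intro mult_right_mono one_le_power) auto
    finally show ?thesis .
  next
    case False
    then have "max (nrm z) 1 ^ d \<le> R ^ d * 1"
      using R_gt_1 by (auto intro!: power_mono)
    also have "\<dots> \<le> R ^ d * max (nrm (unicrit c z)) 1"
      using R_gt_1 by (intro mult_left_mono) auto
    finally show ?thesis .
  qed
  then show ?thesis
    using R_gt_1 by (intro chordal_unicritical_map_le) auto
qed

section \<open>Escaping points and the Fatou set\<close>

definition escaping_set :: "'a \<Rightarrow> 'a proj_line set" where
  "escaping_set c = {x. \<exists>n. chordal nrm ((unicritical_map d c ^^ n) x) Infinity < 1 / R}"

lemma unicritical_map_iterate: "(unicritical_map d c ^^ n) (Affine z) = Affine ((unicrit c ^^ n) z)"
  unfolding unicritical_map_funpow_Affine unicrit_def[abs_def] ..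

lemma escaping_set_eq:
  assumes "nrm c = R ^ d"
  shows "escaping_set c = - Affine ` filled_julia c"
proof (intro set_eqI)
  fix x
  show "x \<in> escaping_set c \<longleftrightarrow> x \<in> - Affine ` filled_julia c"
  proof (cases x)
    case (Affine z)
    have "x \<in> escaping_set c \<longleftrightarrow> (\<exists>n. R < nrm ((unicrit c ^^ n) z))"
      unfolding Affine escaping_set_def mem_Collect_eq unicritical_map_iterate escape_region_iff ..
    also have "\<dots> \<longleftrightarrow> z \<notin> filled_julia c"
      unfolding filled_julia_iff[OF assms] by (simp add: not_le)
    finally show ?thesis using Affine by auto
  next
    case Infinity
    then show ?thesis
      using R_gt_1 by (auto simp: escaping_set_def intro!: exI[of _ 0])
  qed
qed

text \<open>Yields openness and equicontinuity at once: the Lipschitz bound controls the finitely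
  many steps before escape, and afterwards distances do not increase.\<close>

lemma escaping_set_locally_stable:
  assumes c: "nrm c = R ^ d" and x: "x \<in> escaping_set c" and "e > 0"
  shows "\<exists>\<delta>>0. \<forall>y. chordal nrm x y < \<delta> \<longrightarrow> y \<in> escaping_set c \<and>
    (\<forall>n. chordal nrm ((unicritical_map d c ^^ n) x) ((unicritical_map d c ^^ n) y) < e)"
proof -
  interpret C: Metric_space UNIV "chordal nrm" by (rule chordal_Metric_space)
  let ?F = "\<lambda>n. unicritical_map d c ^^ n"
  let ?V = "\<lambda>x. chordal nrm x Infinity < 1 / R"
  obtain N where N: "?V (?F N x)" using x by (auto simp: escaping_set_def)
  define K where "K = (R ^ d)\<^sup>2"
  have K: "K \<ge> 1" unfolding K_def using R_gt_1 by (intro one_le_power) auto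
  have Lip: "chordal nrm (?F n x) (?F n y) \<le> K ^ n * chordal nrm x y" for n y
  proof (induction n)
    case (Suc n)
    have "chordal nrm (?F (Suc n) x) (?F (Suc n) y) \<le> K * chordal nrm (?F n x) (?F n y)"
      using chordal_unicritical_map_Lipschitz[OF c] by (simp add: K_def)
    also have "\<dots> \<le> K * (K ^ n * chordal nrm x y)"
      using Suc K by (intro mult_left_mono) auto
    finally show ?case by (simp add: mult.assoc)
  qed simp
  \<comment> \<open>The second term is the room left in the escape region at time \<open>N\<close>,
    so nearby points have escaped by then as well.\<close>
  define \<eta> where "\<eta> = min e (1 / R - chordal nrm (?F N x) Infinity)"
  have \<eta>: "\<eta> > 0" using N \<open>e > 0\<close> by (simp add: \<eta>_def)
  have "y \<in> escaping_set c \<and> (\<forall>n. chordal nrm (?F n x) (?F n y) < e)"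
    if y: "chordal nrm x y < \<eta> / K ^ N" for y
  proof -
    have early: "chordal nrm (?F n x) (?F n y) < \<eta>" if "n \<le> N" for n
    proof -
      have "chordal nrm (?F n x) (?F n y) \<le> K ^ N * chordal nrm x y"
        using Lip[of n y] K that
        by (meson C.nonneg mult_right_mono order_trans power_increasing)
      also have "\<dots> < \<eta>" using y K by (simp add: field_simps)
      finally show ?thesis .
    qed
    have Vy: "?V (?F N y)"
      using early[of N] C.triangle[of "?F N y" "?F N x" Infinity] C.commute[of "?F N y" "?F N x"]
      by (simp add: \<eta>_def)
    have late: "?V (?F (j + N) x) \<and> ?V (?F (j + N) y) \<and>
        chordal nrm (?F (j + N) x) (?F (j + N) y) < \<eta>" for j
    proof (induction j)
      case 0
      then show ?case using N Vy early[of N] by simp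
    next
      case (Suc j)
      then show ?case
        using escape_region_invariant[OF c] chordal_escape_region_le[OF c]
        by (auto intro: le_less_trans)
    qed
    have "chordal nrm (?F n x) (?F n y) < \<eta>" for n
      using early[of n] late[of "n - N"] by (cases "n \<le> N") auto
    then show ?thesis
      using Vy by (auto simp: escaping_set_def \<eta>_def)
  qed
  moreover have "\<eta> / K ^ N > 0" using \<eta> K by simp
  ultimately show ?thesis by blast
qed

lemma escaping_set_subset_fatou_set:
  assumes c: "nrm c = R ^ d"
  shows "escaping_set c \<subseteq> fatou_set nrm (unicritical_map d c)"
proof (rule fatou_set_greatest)
  interpret C: Metric_space UNIV "chordal nrm" by (rule chordal_Metric_space)
  show "openin C.mtopology (escaping_set c)"
    unfolding C.openin_mtopology
  proof (intro conjI allI impI)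
    fix x assume "x \<in> escaping_set c"
    then show "\<exists>r>0. C.mball x r \<subseteq> escaping_set c"
      using escaping_set_locally_stable[OF c _ zero_less_one, of x]
      by (auto simp: C.mball_def subset_iff)
  qed simp
  show "iterates_equicontinuous_on nrm (unicritical_map d c) (escaping_set c)"
    unfolding iterates_equicontinuous_on_def
    using escaping_set_locally_stable[OF c] by meson
qed

section \<open>Identification of the Julia set\<close>

lemma chordal_separated:
  assumes "nrm a = R" "R \<le> nrm (a - b)"
  shows "1 / R \<le> chordal nrm (Affine a) (Affine b)"
proof -
  have "nrm b \<le> max (nrm a) (nrm (a - b))"
    using nrm_diff_le_max[of a "a - b"] by simp
  then have "max (nrm b) 1 \<le> nrm (a - b)"
    using assms R_gt_1 by auto
  moreover have "max (nrm b) 1 > 0" by simp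
  ultimately show ?thesis
    using assms R_gt_1 by (simp add: field_simps)
qed

lemma julia_set_eq:
  assumes c: "nrm c = R ^ d"
  shows "julia_set nrm (unicritical_map d c) = Affine ` filled_julia c"
proof -
  interpret C: Metric_space UNIV "chordal nrm" by (rule chordal_Metric_space)
  let ?f = "unicritical_map d c"
  have "Affine z \<notin> fatou_set nrm ?f" if z: "z \<in> filled_julia c" for z
  proof
    assume fatou: "Affine z \<in> fatou_set nrm ?f"
    have "1 / R > 0" using R_gt_1 by simp
    then obtain \<delta> where \<delta>: "\<delta> > 0"
      "\<And>w n. w \<in> fatou_set nrm ?f \<Longrightarrow> chordal nrm (Affine z) w < \<delta> \<Longrightarrow>
        chordal nrm ((?f ^^ n) (Affine z)) ((?f ^^ n) w) < 1 / R"
      using fatou_set_equicontinuous[of ?f] fatou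
      unfolding iterates_equicontinuous_on_def by meson
    obtain r where r: "r > 0" "C.mball (Affine z) r \<subseteq> fatou_set nrm ?f"
      using fatou openin_fatou_set unfolding C.openin_mtopology by blast
    \<comment> \<open>Below \<open>r\<close> the point \<open>z + u\<close> is still in the Fatou
      set; below \<open>\<delta>\<close> equicontinuity forbids the separation that expansivity
      forces.\<close>
    obtain u where u: "u \<noteq> 0" "nrm u < min \<delta> r"
      using exists_small_nonzero[of "min \<delta> r"] \<delta> r by auto
    have "1 \<le> max (nrm z) 1 * max (nrm (z + u)) 1"
      using mult_mono[of 1 "max (nrm z) 1" 1 "max (nrm (z + u)) 1"] by simp
    then have "nrm u * 1 \<le> nrm u * (max (nrm z) 1 * max (nrm (z + u)) 1)"
      by (intro mult_left_mono nrm_nonneg)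
    then have "chordal nrm (Affine z) (Affine (z + u)) \<le> nrm u"
      using nrm_nonneg[of u] by (simp add: nrm_minus divide_le_eq)
    then have near: "chordal nrm (Affine z) (Affine (z + u)) < min \<delta> r" using u by linarith
    then have "Affine (z + u) \<in> fatou_set nrm ?f"
      using r by (auto simp: C.mball_def simp del: chordal.simps)
    then have "chordal nrm ((?f ^^ n) (Affine z)) ((?f ^^ n) (Affine (z + u))) < 1 / R" for n
      using \<delta>(2) near by simp
    moreover obtain n where "R \<le> nrm ((unicrit c ^^ n) z - (unicrit c ^^ n) (z + u))"
      using first_separation[OF z, of "z + u"] u by auto
    ultimately show False
      using chordal_separated filled_juliaD[OF z] by (metis unicritical_map_iterate not_le)
  qed
  then show ?thesis
    using escaping_set_subset_fatou_set[OF c] escaping_set_eq[OF c]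
    by (auto simp: julia_set_def)
qed

subsection \<open>Shadowing\<close>

definition shadows :: "'a \<Rightarrow> 'a \<Rightarrow> 'a \<Rightarrow> 'a \<Rightarrow> bool" where
  "shadows c c' z y \<longleftrightarrow> (\<forall>n. nrm ((unicrit c ^^ n) z - (unicrit c' ^^ n) y) < R)"

lemma shadows_sym: "shadows c c' z y \<Longrightarrow> shadows c' c y z"
  by (simp add: shadows_def nrm_minus_commute)

lemma shadows_unicrit: "shadows c c' z y \<Longrightarrow> shadows c c' (unicrit c z) (unicrit c' y)"
  unfolding shadows_def by (metis comp_apply funpow_Suc_right)

text \<open>Because closeness is transitive in an ultrametric, shadowing composes without loss in
  the constant \<open>R\<close>.\<close>

lemma close_trans: "nrm (x - y) < R \<Longrightarrow> nrm (y - z) < R \<Longrightarrow> nrm (x - z) < R"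
  using nrm_diff_ultrametric[of x z y] by linarith

lemma shadows_unique:
  assumes "y \<in> filled_julia c'" "shadows c c' z y" "shadows c c' z y'"
  shows "y = y'"
proof (rule ccontr)
  assume "y \<noteq> y'"
  then obtain n where "R \<le> nrm ((unicrit c' ^^ n) y - (unicrit c' ^^ n) y')"
    using first_separation[OF assms(1)] by blast
  moreover have "nrm ((unicrit c' ^^ n) y - (unicrit c' ^^ n) y') < R"
    using assms(2,3) unfolding shadows_def by (metis close_trans nrm_minus_commute)
  ultimately show False by simp
qed

text \<open>Up to the first separation of \<open>z\<close> and \<open>w\<close>, the shadows stay
  close too, so both distances grow by the same factor. Exchanging the roles gives the reverse
  inequality.\<close>

lemma shadows_nrm_diff_le:
  assumes z: "z \<in> filled_julia c" and w: "w \<in> filled_julia c"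
    and y: "y \<in> filled_julia c'" and v: "v \<in> filled_julia c'"
    and zy: "shadows c c' z y" and wv: "shadows c c' w v"
  shows "nrm (y - v) \<le> nrm (z - w)"
proof (cases "z = w")
  case True
  then have "y = v" using shadows_unique[OF y zy] wv by simp
  then show ?thesis using nrm_nonneg by (simp add: nrm_zero)
next
  case False
  let ?f = "\<lambda>n. unicrit c ^^ n" and ?g = "\<lambda>n. unicrit c' ^^ n"
  obtain n where n: "R \<le> nrm (?f n z - ?f n w)" "\<And>k. k < n \<Longrightarrow> nrm (?f k z - ?f k w) < R"
    using first_separation[OF z False] by blast
  have "nrm (?g k y - ?g k v) < R" if "k < n" for k
  proof -
    have "nrm (?g k y - ?f k z) < R" "nrm (?f k w - ?g k v) < R"
      using zy wv by (simp_all add: shadows_def nrm_minus_commute)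
    then show ?thesis using n(2)[OF that] close_trans by blast
  qed
  then have "(R ^ (d - 1)) ^ n * nrm (y - v) = nrm (?g n y - ?g n v)"
    using filled_juliaD[OF y] by (simp add: nrm_iterate_diff)
  \<comment> \<open>Two points of the sphere are at most \<open>R\<close> apart.\<close>
  also have "\<dots> \<le> R"
    using nrm_diff_le_max[of "?g n y" "?g n v"] filled_juliaD y v by simp
  also have "\<dots> \<le> nrm (?f n z - ?f n w)" by (rule n)
  also have "\<dots> = (R ^ (d - 1)) ^ n * nrm (z - w)"
    using filled_juliaD[OF z] n(2) by (intro nrm_iterate_diff)
  finally show ?thesis using expansion_gt_1 by simp
qed

section \<open>Existence of shadows\<close>

text \<open>Induction backwards along the orbit: a shadow of \<open>unicrit c z\<close> is pulled
  back through the branch of the \<open>d\<close>-th root near \<open>z\<close>.\<close>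

lemma exists_finite_shadow:
  assumes "nrm (c - c') \<le> R" "z \<in> filled_julia c"
  shows "\<exists>y. \<forall>k\<le>n. nrm ((unicrit c ^^ k) z - (unicrit c' ^^ k) y) < R"
  using assms(2)
proof (induction n arbitrary: z)
  case 0
  then show ?case using R_gt_1 by (intro exI[of _ z]) (simp add: nrm_zero)
next
  case (Suc n)
  have z: "nrm z = R" using filled_juliaD[OF Suc.prems, of 0] by simp
  obtain y where y: "\<And>k. k \<le> n \<Longrightarrow> nrm ((unicrit c ^^ k) (unicrit c z) - (unicrit c' ^^ k) y) < R"
    using Suc.IH[OF unicrit_mem_filled_julia[OF Suc.prems]] by blast
  have "y - c' - z ^ d = (c - c') - (unicrit c z - y)" by (simp add: unicrit_def)
  then have "nrm (y - c' - z ^ d) \<le> max (nrm (c - c')) (nrm (unicrit c z - y))"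
    by (metis nrm_diff_le_max)
  then have "nrm (y - c' - z ^ d) \<le> R"
    using assms(1) y[of 0] by simp
  \<comment> \<open>The perturbation is at most \<open>R\<close>, well below the bound
    \<open>R ^ d\<close> that root extraction allows.\<close>
  then have "nrm (y - c' - z ^ d) < nrm z ^ d" using z R_less_power by simp
  then obtain x where x: "x ^ d = y - c'" "nrm (x - z) < nrm z"
    using exists_root_near[OF complete nrm_degree] by blast
  have "unicrit c' x = y" using x by (simp add: unicrit_def)
  then have "nrm ((unicrit c ^^ k) z - (unicrit c' ^^ k) x) < R" if "k \<le> Suc n" for k
    using that y[of "k - 1"] x z
    by (cases k) (auto simp: funpow_Suc_right nrm_minus_commute simp del: funpow.simps(2))
  then show ?case by blast
qed

lemma exists_shadow:
  assumes "nrm (c - c') \<le> R" and z: "z \<in> filled_julia c"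
  shows "\<exists>y\<in>filled_julia c'. shadows c c' z y"
proof -
  let ?f = "\<lambda>n. unicrit c ^^ n" and ?g = "\<lambda>n. unicrit c' ^^ n" and ?L = "R ^ (d - 1)"
  obtain y where y: "\<And>n k. k \<le> n \<Longrightarrow> nrm (?f k z - ?g k (y n)) < R"
    using exists_finite_shadow[OF assms] by metis
  have gy: "nrm (?g k (y n)) = R" if "k \<le> n" for k n
    using nrm_eq_of_diff_less[of "?f k z" "?g k (y n)"] y[OF that] filled_juliaD[OF z] by simp
  \<comment> \<open>Both points shadow \<open>z\<close> up to time \<open>n\<close>, so expansion
    forces their initial distance to be exponentially small.\<close>
  have dist: "nrm (y n - y m) < R / ?L ^ n" if "n \<le> m" for n m
  proof -
    have close: "nrm (?g k (y n) - ?g k (y m)) < R" if "k \<le> n" for k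
      using y[OF that] y[of k m] that \<open>n \<le> m\<close> close_trans
      by (metis nrm_minus_commute order_trans)
    then have "?L ^ n * nrm (y n - y m) = nrm (?g n (y n) - ?g n (y m))"
      using gy by (simp add: nrm_iterate_diff)
    also have "\<dots> < R" using close by simp
    finally show ?thesis
      using expansion_gt_1 by (simp add: field_simps)
  qed
  have "MCauchy y"
    unfolding MCauchy_def
  proof (intro conjI allI impI)
    fix e :: real assume e: "e > 0"
    obtain N where "R / e < ?L ^ N" using real_arch_pow[OF expansion_gt_1] by blast
    then have "R / ?L ^ N < e" using e expansion_gt_1 by (simp add: field_simps)
    then have near: "nrm (y N - y n) < e" if "N \<le> n" for n
      using dist[OF that] by linarith
    then have "nrm (y n - y n') < e" if "N \<le> n" "N \<le> n'" for n n'
      using nrm_diff_ultrametric[of "y n" "y n'" "y N"] near[OF that(1)] near[OF that(2)]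
      by (simp add: nrm_minus_commute)
    then show "\<exists>N. \<forall>n n'. N \<le> n \<longrightarrow> N \<le> n' \<longrightarrow> nrm (y n - y n') < e" by blast
  qed simp
  then obtain l where "limitin mtopology y l sequentially"
    using complete unfolding mcomplete_def by blast
  then have l: "\<exists>N. \<forall>n\<ge>N. nrm (y n - l) < e" if "e > 0" for e
    using that by (simp add: limit_metric_sequentially)
  have fg: "nrm (?f k z - ?g k l) < R" for k
  proof -
    have "R / ?L ^ k > 0" using R_gt_1 by simp
    then obtain N where N: "\<And>n. n \<ge> N \<Longrightarrow> nrm (y n - l) < R / ?L ^ k" using l by blast
    \<comment> \<open>Late enough for \<open>y m\<close> to shadow \<open>z\<close> at time
      \<open>k\<close> and to be so near \<open>l\<close> that their \<open>k\<close>-th iterates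
      are still close.\<close>
    define m where "m = max N k"
    have "?L ^ k * nrm (y m - l) < R"
      using N[of m] expansion_gt_1 by (simp add: m_def field_simps)
    then have "nrm (?g k (y m) - ?g k l) < R"
      using gy by (intro iterates_stay_close[of k]) (auto simp: m_def)
    moreover have "nrm (?f k z - ?g k (y m)) < R" using y by (simp add: m_def)
    ultimately show ?thesis using close_trans by blast
  qed
  then have "nrm (?g k l) = R" for k
    using nrm_eq_of_diff_less[of "?f k z" "?g k l"] filled_juliaD[OF z] by simp
  then show ?thesis
    using fg by (auto simp: filled_julia_def shadows_def)
qed

section \<open>The conjugacy\<close>

lemma conjugacy_of_julia_sets:
  assumes c: "nrm c = R ^ d" and c': "nrm c' = R ^ d" and cc': "nrm (c - c') \<le> R"
  defines "J \<equiv> julia_set nrm (unicritical_map d c)"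
    and "J' \<equiv> julia_set nrm (unicritical_map d c')"
  shows "\<exists>h. homeomorphic_map (subtopology (chordal_topology nrm) J)
               (subtopology (chordal_topology nrm) J') h \<and>
             (\<forall>z\<in>J. h (unicritical_map d c z) = unicritical_map d c' (h z))"
proof -
  have J: "J = Affine ` filled_julia c" and J': "J' = Affine ` filled_julia c'"
    using c c' by (simp_all add: J_def J'_def julia_set_eq)
  have c'c: "nrm (c' - c) \<le> R" using cc' by (simp add: nrm_minus_commute)
  obtain g where g: "\<And>z. z \<in> filled_julia c \<Longrightarrow> g z \<in> filled_julia c'"
    "\<And>z. z \<in> filled_julia c \<Longrightarrow> shadows c c' z (g z)"
    using exists_shadow[OF cc'] by metis
  have g_unique: "g z = y" if "z \<in> filled_julia c" "shadows c c' z y" for z y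
    using g[OF that(1)] that(2) shadows_unique by blast
  have isom: "nrm (g z - g w) = nrm (z - w)" if "z \<in> filled_julia c" "w \<in> filled_julia c" for z w
    using that g shadows_sym by (intro antisym shadows_nrm_diff_le) blast+
  \<comment> \<open>The value at \<open>Infinity\<close> is a default, since \<open>J\<close>
    consists of affine points.\<close>
  define h where "h x = (case x of Affine z \<Rightarrow> Affine (g z) | Infinity \<Rightarrow> Infinity)" for x
  have "Affine y \<in> h ` J" if y: "y \<in> filled_julia c'" for y
  proof -
    obtain z where "z \<in> filled_julia c" "shadows c' c y z"
      using exists_shadow[OF c'c y] by blast
    then have "h (Affine z) = Affine y"
      using g_unique shadows_sym by (simp add: h_def)
    then show ?thesis using \<open>z \<in> filled_julia c\<close> unfolding J by (metis imageI)
  qed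
  then have h_image: "h ` J = J'"
    using g unfolding J J' by (auto simp: h_def)
  \<comment> \<open>All points involved have norm \<open>R\<close>, so the chordal denominators
    agree and \<open>isom\<close> carries over.\<close>
  have h_isom: "chordal nrm (h x) (h y) = chordal nrm x y" if xy: "x \<in> J" "y \<in> J" for x y
  proof -
    obtain z w where "x = Affine z" "z \<in> filled_julia c" "y = Affine w" "w \<in> filled_julia c"
      using xy unfolding J by blast
    moreover have "nrm v = R \<and> nrm (g v) = R" if "v \<in> filled_julia c" for v
      using filled_juliaD[OF that, of 0] filled_juliaD[OF g(1)[OF that], of 0] by simp
    ultimately show ?thesis
      using isom by (simp add: h_def)
  qed
  interpret C: Metric_space UNIV "chordal nrm" by (rule chordal_Metric_space)
  interpret CJ: Submetric UNIV "chordal nrm" J by unfold_locales simp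
  interpret CJ': Submetric UNIV "chordal nrm" J' by unfold_locales simp
  interpret Metric_space12 J "chordal nrm" J' "chordal nrm" by unfold_locales
  have "homeomorphic_map CJ.sub.mtopology CJ'.sub.mtopology h"
    using h_image h_isom by (rule isometry_imp_homeomorphic_map)
  moreover have "h (unicritical_map d c x) = unicritical_map d c' (h x)" if x: "x \<in> J" for x
  proof -
    obtain z where z: "x = Affine z" "z \<in> filled_julia c" using x unfolding J by blast
    \<comment> \<open>The right-hand side shadows \<open>unicrit c z\<close>, and shadows are
      unique.\<close>
    have "g (unicrit c z) = unicrit c' (g z)"
      using z g unicrit_mem_filled_julia shadows_unicrit g_unique by blast
    then show ?thesis using z by (simp add: h_def unicrit_def)
  qed
  ultimately show ?thesis
    unfolding CJ.mtopology_submetric CJ'.mtopology_submetric by blast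
qed

end

text \<open>The closed unit disc is invariant; hence an escaping critical orbit forces |c| >
  1.\<close>

lemma (in ultrametric_field) critical_orbit_bounded:
  assumes "nrm c \<le> 1"
  shows "nrm (((\<lambda>z. z ^ d + c) ^^ k) 0) \<le> 1"
proof (induction k)
  case (Suc k)
  then have "nrm ((((\<lambda>z. z ^ d + c) ^^ k) 0) ^ d) \<le> 1"
    unfolding nrm_power by (intro power_le_one nrm_nonneg)
  then show ?case
    using assms nrm_ultrametric[of "(((\<lambda>z. z ^ d + c) ^^ k) 0) ^ d" c] by simp
qed (simp add: nrm_zero)

theorem theorem1p3:
  fixes p d :: nat and nrm :: "'a::field_char_0 \<Rightarrow> real" and c c' :: 'a
  assumes "prime p"
    and "padic_complex_field p nrm"
    and "d \<ge> 2"
    and "\<not> p dvd d"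
    and "filterlim (\<lambda>k. nrm (((\<lambda>z. z ^ d + c) ^^ k) 0)) at_top sequentially"
    and "filterlim (\<lambda>k. nrm (((\<lambda>z. z ^ d + c') ^^ k) 0)) at_top sequentially"
    and "nrm (c - c') \<le> nrm c powr (1 / real d)"
  shows "\<exists>h. homeomorphic_map
               (subtopology (chordal_topology nrm) (julia_set nrm (unicritical_map d c)))
               (subtopology (chordal_topology nrm) (julia_set nrm (unicritical_map d c'))) h \<and>
             (\<forall>z \<in> julia_set nrm (unicritical_map d c).
               h (unicritical_map d c z) = unicritical_map d c' (h z))"
proof -
  interpret padic_complex_field p nrm by fact
  have c1: "nrm c > 1"
  proof (rule ccontr)
    assume "\<not> nrm c > 1"
    then have bounded: "nrm (((\<lambda>z. z ^ d + c) ^^ k) 0) \<le> 1" for k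
      by (intro critical_orbit_bounded) simp
    have "eventually (\<lambda>k. nrm (((\<lambda>z. z ^ d + c) ^^ k) 0) > 1) sequentially"
      using assms(5) unfolding filterlim_at_top_dense by blast
    then show False using bounded by (simp add: not_less[symmetric])
  qed
  define R where "R = nrm c powr (1 / real d)"
  have R: "R > 1" "R ^ d = nrm c"
    using c1 \<open>d \<ge> 2\<close> by (simp_all add: R_def powr_power)
  interpret tame_unicritical p nrm d R
    using assms R by unfold_locales auto
  have cc': "nrm (c - c') \<le> R" using assms(7) by (simp add: R_def)
  \<comment> \<open>As \<open>R < R ^ d = nrm c\<close>, the isosceles principle gives
    \<open>c'\<close> the same norm, so one \<open>R\<close> serves both maps.\<close>
  then have "nrm (c - c') < nrm c" using R_less_power R by simp
  then have "nrm c' = R ^ d" using nrm_eq_of_diff_less[of c c'] R by simp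
  then show ?thesis using conjugacy_of_julia_sets[OF R(2)[symmetric] _ cc'] by simp
qed

end
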